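(* Let $(G,\mathsf X)$ be a contracting self-similar action with nucleus $\mathcal N$ and limit space $\mathcal J_G$, and let $p:\mathsf X^{-\omega}\to\mathcal J_G$ be the quotient map. Then $\mathcal J_G$ has a self-similar structure (i.e. there is a self-similar structure $(\mathcal J_G,\mathsf X,\{F_i\}_{i\in\mathsf X})$ whose associated surjection is $p$) if and only if the following condition holds: for every left-infinite path $\ldots e_2e_1$ in the Moore diagram of $\mathcal N$ ending at a non-trivial state and for every $w\in\mathsf X^*$, there exists a left-infinite path $\ldots f_2f_1$ in the Moore diagram of $\mathcal N$, ending at some state $g$, such that for every $n\ge 1$ the label of $f_n$ is the same as the label of $e_n$, and $g(w)=w$.
   Context: Let $\mathsf X$ be a finite set (the alphabet). $\mathsf X^*$ is the set of finite words $x_n\ldots x_2x_1$ over $\mathsf X$ (including the empty word $\varnothing$), a rooted tree with root $\varnothing$ in which $w$ is joined to $wx$ for $x\in\mathsf X$. $\mathsf X^{-\omega}$ is the set of left-infinite words $\ldots x_2x_1$ with the product topology ($\mathsf X$ discrete). $\operatorname{Aut}\mathsf X^*$ is the group of rooted tree automorphisms; for $g\in\operatorname{Aut}\mathsf X^*$ and $v\in\mathsf X^*$ the restriction $g|_v$ is defined by $g(vw)=g(v)\,g|_v(w)$ for all $w\in\mathsf X^*$ (words are read from left to right). A self-similar action $(G,\mathsf X)$ is a faithful action of a group $G$ on $\mathsf X^*$ by automorphisms (so $G\le\operatorname{Aut}\mathsf X^*$) such that $g|_x\in G$ for all $g\in G$, $x\in\mathsf X$. It is contracting if there is a finite set $\mathcal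 N\subset G$ such that for every $g\in G$ there is $k\in\mathbb N$ with $g|_w\in\mathcal N$ whenever $|w|\ge k$; the smallest such $\mathcal N$ is the nucleus. The Moore diagram of $\mathcal N$ is the directed graph with vertex set $\mathcal N$ (vertices are called states) having, for every $g\in\mathcal N$ and $x\in\mathsf X$, an arrow from $g$ to $g|_x$ labeled $(x,g(x))$. A left-infinite path $\ldots e_2e_1$ is a sequence of arrows such that $e_{n+1}$ ends where $e_n$ starts; it ends at the end vertex of $e_1$. A state is non-trivial if it is not the identity. Two words $\ldots x_2x_1,\ \ldots y_2y_1\in\mathsf X^{-\omega}$ are asymptotically equivalent if there is a sequence $(g_k)_{k\ge1}$ in $G$, taking only finitely many values, with $g_k(x_k\ldots x_1)=y_k\ldots y_1$ for all $k$. The limit space $\mathcal J_G$ is the quotient topological space of $\mathsf X^{-\omega}$ by this relation, with quotient map $p$. A self-similar structure on a compact metrizable space $K$ is a system $(K,\mathsf X,\{F_i\}_{i\in\mathsf X})$ of continuous injections $F_i:K\to K$ for which there is a continuous surjection $\pi:\mathsf X^{-\omega}\to K$ with $F_i\circ\pi=\pi\circ i$ for all $i\in\mathsf X$, where $i(\ldots x_2x_1)=\ldots x_2x_1i$; $\pi$ is then unique and is called the associated surjection. *)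

theory Defs
  imports "HOL-Analysis.Analysis" "HOL-Algebra.Group"
begin

section \<open>The tree of words and its automorphisms\<close>

text \<open>
  The alphabet is a type \<open>'x\<close> of class \<open>finite\<close>. A finite word \<open>x\<^sub>n \<dots> x\<^sub>2 x\<^sub>1\<close> is the list
  \<open>[x\<^sub>n, \<dots>, x\<^sub>2, x\<^sub>1]\<close>; words are read from left to right, i.e. from the head of the list.
\<close>

definition tree_adj :: "'x list \<Rightarrow> 'x list \<Rightarrow> bool" where
  "tree_adj u v \<longleftrightarrow> (\<exists>x. v = u @ [x]) \<or> (\<exists>x. u = v @ [x])"

definition tree_automorphism :: "('x list \<Rightarrow> 'x list) \<Rightarrow> bool" where
  "tree_automorphism g \<longleftrightarrow>
     bij g \<and> g [] = [] \<and> (\<forall>u v. tree_adj (g u) (g v) \<longleftrightarrow> tree_adj u v)"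

definition tree_Aut :: "('x list \<Rightarrow> 'x list) monoid" where
  "tree_Aut = \<lparr>carrier = {g. tree_automorphism g}, mult = (\<circ>), one = id\<rparr>"

definition restr :: "('x list \<Rightarrow> 'x list) \<Rightarrow> 'x list \<Rightarrow> 'x list \<Rightarrow> 'x list" where
  "restr g v = (\<lambda>w. drop (length (g v)) (g (v @ w)))"

lemma tree_automorphism_length: "tree_automorphism g \<Longrightarrow> length (g w) = length w"
  and tree_automorphism_snoc: "tree_automorphism g \<Longrightarrow> \<exists>y. g (w @ [x]) = g w @ [y]"
proof -
  assume g: "tree_automorphism g"
  have *: "length (g w) = length w \<and> (\<forall>x. \<exists>y. g (w @ [x]) = g w @ [y])" for w
  proof (induction w rule: rev_induct)
    case Nil
    have nil: "g [] = []" using g by (simp add: tree_automorphism_def)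
    have "tree_adj [] [x]" for x :: 'a by (simp add: tree_adj_def)
    then have "tree_adj [] (g [x])" for x
      using g nil unfolding tree_automorphism_def by metis
    then show ?case by (simp add: nil tree_adj_def)
  next
    case (snoc z u)
    then obtain z' where z': "g (u @ [z]) = g u @ [z']" by blast
    have "\<exists>y. g ((u @ [z]) @ [x]) = g (u @ [z]) @ [y]" for x
    proof -
      have "tree_adj (u @ [z]) ((u @ [z]) @ [x])" unfolding tree_adj_def by blast
      then have "tree_adj (g (u @ [z])) (g ((u @ [z]) @ [x]))"
        using g unfolding tree_automorphism_def by blast
      moreover have "g (u @ [z]) \<noteq> g ((u @ [z]) @ [x]) @ [y]" for y
      proof
        assume "g (u @ [z]) = g ((u @ [z]) @ [x]) @ [y]"
        then have "g u = g ((u @ [z]) @ [x])" using z' by simp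
        then have "u = (u @ [z]) @ [x]"
          using g by (metis tree_automorphism_def bij_def injD)
        then show False by simp
      qed
      ultimately show ?thesis unfolding tree_adj_def by blast
    qed
    then show ?case using snoc z' by simp
  qed
  show "length (g w) = length w" "\<exists>y. g (w @ [x]) = g w @ [y]"
    using * by blast+
qed

lemma restr_eq:
  assumes "tree_automorphism g"
  shows "g (v @ w) = g v @ restr g v w"
proof -
  have "\<exists>u. g (v @ w) = g v @ u"
  proof (induction w rule: rev_induct)
    case (snoc x w)
    then show ?case
      using tree_automorphism_snoc[OF assms, of "v @ w" x] by auto
  qed simp
  then show ?thesis by (auto simp: restr_def)
qed

lemma group_tree_Aut: "group (tree_Aut :: ('x list \<Rightarrow> 'x list) monoid)"
proof (rule groupI)
  fix g :: "'x list \<Rightarrow> 'x list" assume "g \<in> carrier tree_Aut"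
  then have g: "bij g" "g [] = []" "\<And>u v. tree_adj (g u) (g v) \<longleftrightarrow> tree_adj u v"
    by (auto simp: tree_Aut_def tree_automorphism_def)
  have gi: "g (inv_into UNIV g v) = v" for v
    using g(1) by (simp add: bij_is_surj surj_f_inv_f)
  have "tree_automorphism (inv_into UNIV g)"
    unfolding tree_automorphism_def
  proof (intro conjI allI)
    show "bij (inv_into UNIV g)" using g(1) by (rule bij_imp_bij_inv)
    show "inv_into UNIV g [] = []" using g(1,2) by (metis bij_inv_eq_iff)
    show "tree_adj (inv_into UNIV g u) (inv_into UNIV g v) \<longleftrightarrow> tree_adj u v" for u v
      using g(3)[of "inv_into UNIV g u" "inv_into UNIV g v"] by (simp add: gi)
  qed
  then show "\<exists>h \<in> carrier tree_Aut. mult tree_Aut h g = one tree_Aut"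
    using g(1) by (intro bexI[of _ "inv_into UNIV g"]) (auto simp: tree_Aut_def bij_def)
qed (auto simp: tree_Aut_def tree_automorphism_def comp_assoc bij_comp)


section \<open>Contracting self-similar actions\<close>

definition self_similar_action :: "('x::finite list \<Rightarrow> 'x list) set \<Rightarrow> bool" where
  "self_similar_action G \<longleftrightarrow> subgroup G tree_Aut \<and> (\<forall>g\<in>G. \<forall>x. restr g [x] \<in> G)"

definition absorbing_set :: "('x list \<Rightarrow> 'x list) set \<Rightarrow> ('x list \<Rightarrow> 'x list) set \<Rightarrow> bool" where
  "absorbing_set G N \<longleftrightarrow>
     finite N \<and> N \<subseteq> G \<and> (\<forall>g\<in>G. \<exists>k. \<forall>w. length w \<ge> k \<longrightarrow> restr g w \<in> N)"

definition contracting :: "('x list \<Rightarrow> 'x list) set \<Rightarrow> bool" where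
  "contracting G \<longleftrightarrow> (\<exists>N. absorbing_set G N)"

definition nucleus :: "('x list \<Rightarrow> 'x list) set \<Rightarrow> ('x list \<Rightarrow> 'x list) set" where
  "nucleus G = (LEAST N. absorbing_set G N)"

lemma absorbing_set_Int:
  assumes "absorbing_set G M" "absorbing_set G N"
  shows "absorbing_set G (M \<inter> N)"
  unfolding absorbing_set_def
proof (intro conjI ballI)
  fix g assume "g \<in> G"
  then obtain k l where "\<forall>w. length w \<ge> k \<longrightarrow> restr g w \<in> M" "\<forall>w. length w \<ge> l \<longrightarrow> restr g w \<in> N"
    using assms unfolding absorbing_set_def by meson
  then show "\<exists>k. \<forall>w. length w \<ge> k \<longrightarrow> restr g w \<in> M \<inter> N"
    by (intro exI[of _ "max k l"]) auto
qed (use assms in \<open>auto simp: absorbing_set_def\<close>)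

lemma nucleus_least:
  assumes "contracting G"
  shows "absorbing_set G (nucleus G)" and "absorbing_set G M \<Longrightarrow> nucleus G \<subseteq> M"
proof -
  define N where "N = arg_min card (absorbing_set G)"
  obtain N0 where "absorbing_set G N0" using assms by (auto simp: contracting_def)
  then have N: "absorbing_set G N" "\<And>M. absorbing_set G M \<Longrightarrow> card N \<le> card M"
    unfolding N_def by (auto intro: arg_min_natI arg_min_nat_le)
  have le: "N \<subseteq> M" if "absorbing_set G M" for M
  proof -
    have "card N \<le> card (N \<inter> M)" using N that by (blast intro: absorbing_set_Int)
    moreover have "finite N" using N(1) by (simp add: absorbing_set_def)
    ultimately have "N \<inter> M = N" by (metis card_seteq inf_le1)
    then show ?thesis by blast
  qed
  have "nucleus G = N"
    unfolding nucleus_def using N(1) le by (intro Least_equality) auto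
  then show "absorbing_set G (nucleus G)" "absorbing_set G M \<Longrightarrow> nucleus G \<subseteq> M"
    using N(1) le by auto
qed


section \<open>Moore diagram\<close>

text \<open>An arrow is a triple (start, label, end).\<close>

type_synonym 'x arrow = "('x list \<Rightarrow> 'x list) \<times> ('x \<times> 'x) \<times> ('x list \<Rightarrow> 'x list)"

definition arrow_start :: "'x arrow \<Rightarrow> 'x list \<Rightarrow> 'x list" where
  "arrow_start = fst"

definition arrow_label :: "'x arrow \<Rightarrow> 'x \<times> 'x" where
  "arrow_label = fst \<circ> snd"

definition arrow_end :: "'x arrow \<Rightarrow> 'x list \<Rightarrow> 'x list" where
  "arrow_end = snd \<circ> snd"

definition moore_arrows :: "('x list \<Rightarrow> 'x list) set \<Rightarrow> 'x arrow set" where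
  "moore_arrows N = {(g, (x, y), restr g [x]) | g x y. g \<in> N \<and> g [x] = [y]}"

text \<open>
  Left-infinite sequences \<open>\<dots> a\<^sub>2 a\<^sub>1\<close> (of arrows or of letters) are functions on \<open>nat\<close> whose value
  at \<open>n\<close> is \<open>a\<close> with index \<open>n + 1\<close>.
\<close>

definition left_infinite_path :: "('x list \<Rightarrow> 'x list) set \<Rightarrow> (nat \<Rightarrow> 'x arrow) \<Rightarrow> bool" where
  "left_infinite_path N e \<longleftrightarrow>
     (\<forall>n. e n \<in> moore_arrows N) \<and> (\<forall>n. arrow_end (e (Suc n)) = arrow_start (e n))"

definition path_end :: "(nat \<Rightarrow> 'x arrow) \<Rightarrow> 'x list \<Rightarrow> 'x list" where
  "path_end e = arrow_end (e 0)"


section \<open>The limit space\<close>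

definition left_words :: "(nat \<Rightarrow> 'x) topology" where
  "left_words = product_topology (\<lambda>_. discrete_topology UNIV) UNIV"

text \<open>The word \<open>x\<^sub>k \<dots> x\<^sub>1\<close>.\<close>

definition last_letters :: "(nat \<Rightarrow> 'x) \<Rightarrow> nat \<Rightarrow> 'x list" where
  "last_letters x k = rev (map x [0..<k])"

definition asymptotic_rel :: "('x list \<Rightarrow> 'x list) set \<Rightarrow> ((nat \<Rightarrow> 'x) \<times> (nat \<Rightarrow> 'x)) set" where
  "asymptotic_rel G = {(x, y). \<exists>g :: nat \<Rightarrow> 'x list \<Rightarrow> 'x list.
     (\<forall>k\<ge>1. g k \<in> G) \<and> finite (g ` {1..}) \<and>
     (\<forall>k\<ge>1. g k (last_letters x k) = last_letters y k)}"

definition limit_map :: "('x list \<Rightarrow> 'x list) set \<Rightarrow> (nat \<Rightarrow> 'x) \<Rightarrow> (nat \<Rightarrow> 'x) set" where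
  "limit_map G x = asymptotic_rel G `` {x}"

definition limit_space :: "('x list \<Rightarrow> 'x list) set \<Rightarrow> (nat \<Rightarrow> 'x) set topology" where
  "limit_space G = topology (\<lambda>U. U \<subseteq> UNIV // asymptotic_rel G \<and>
     openin left_words {x. limit_map G x \<in> U})"

lemma equiv_asymptotic_rel:
  assumes G: "subgroup G tree_Aut"
  shows "equiv UNIV (asymptotic_rel G)"
proof (rule equivI)
  have one: "id \<in> G" using subgroup.one_closed[OF G] by (simp add: tree_Aut_def)
  show "refl (asymptotic_rel G)"
  proof (rule refl_onI)
    fix x :: "nat \<Rightarrow> 'a"
    show "(x, x) \<in> asymptotic_rel G"
      unfolding asymptotic_rel_def using one
      by (auto intro!: exI[of _ "\<lambda>_. id"] simp: image_constant_conv)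
  qed
  show "sym (asymptotic_rel G)"
  proof (rule symI)
    fix x y assume "(x, y) \<in> asymptotic_rel G"
    then obtain g where g: "\<forall>k\<ge>1. g k \<in> G" "finite (g ` {1..})"
      "\<forall>k\<ge>1. g k (last_letters x k) = last_letters y k"
      unfolding asymptotic_rel_def by auto
    let ?h = "\<lambda>k. m_inv tree_Aut (g k)"
    have "?h k (last_letters y k) = last_letters x k" if "k \<ge> 1" for k
    proof -
      have "g k \<in> carrier tree_Aut" using g(1) that subgroup.subset[OF G] by blast
      then have "?h k \<circ> g k = id"
        using group.l_inv[OF group_tree_Aut] by (simp add: tree_Aut_def)
      then show ?thesis using g(3) that by (metis comp_apply id_apply)
    qed
    moreover have "finite (?h ` {1..})"
      using finite_imageI[OF g(2), of "m_inv tree_Aut"] by (simp add: image_image)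
    moreover have "\<forall>k\<ge>1. ?h k \<in> G" using g(1) subgroup.m_inv_closed[OF G] by auto
    ultimately show "(y, x) \<in> asymptotic_rel G"
      unfolding asymptotic_rel_def by (auto intro!: exI[of _ ?h])
  qed
  show "trans (asymptotic_rel G)"
  proof (rule transI)
    fix x y z assume "(x, y) \<in> asymptotic_rel G" "(y, z) \<in> asymptotic_rel G"
    then obtain g h where g: "\<forall>k\<ge>1. g k \<in> G" "finite (g ` {1..})"
        "\<forall>k\<ge>1. g k (last_letters x k) = last_letters y k"
      and h: "\<forall>k\<ge>1. h k \<in> G" "finite (h ` {1..})"
        "\<forall>k\<ge>1. h k (last_letters y k) = last_letters z k"
      unfolding asymptotic_rel_def by blast
    let ?f = "\<lambda>k. h k \<circ> g k"
    have "?f ` {1..} \<subseteq> (\<lambda>(a, b). a \<circ> b) ` (h ` {1..} \<times> g ` {1..})" by auto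
    then have "finite (?f ` {1..})" using g(2) h(2) finite_subset by blast
    moreover have "\<forall>k\<ge>1. ?f k \<in> G"
      using g(1) h(1) subgroup.m_closed[OF G] by (auto simp: tree_Aut_def)
    moreover have "\<forall>k\<ge>1. ?f k (last_letters x k) = last_letters z k" using g(3) h(3) by simp
    ultimately show "(x, z) \<in> asymptotic_rel G"
      unfolding asymptotic_rel_def mem_Collect_eq prod.case by (intro exI[of _ ?f]) blast
  qed
qed simp

lemma openin_limit_space:
  "openin (limit_space G) U \<longleftrightarrow>
     U \<subseteq> UNIV // asymptotic_rel G \<and> openin left_words {x. limit_map G x \<in> U}"
proof -
  have "istopology (\<lambda>U. U \<subseteq> UNIV // asymptotic_rel G \<and> openin left_words {x. limit_map G x \<in> U})"
    unfolding istopology_def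
  proof (intro conjI allI impI)
    fix S T
    assume "S \<subseteq> UNIV // asymptotic_rel G \<and> openin left_words {x. limit_map G x \<in> S}"
      "T \<subseteq> UNIV // asymptotic_rel G \<and> openin left_words {x. limit_map G x \<in> T}"
    then show "S \<inter> T \<subseteq> UNIV // asymptotic_rel G" "openin left_words {x. limit_map G x \<in> S \<inter> T}"
      using openin_Int[of left_words "{x. limit_map G x \<in> S}" "{x. limit_map G x \<in> T}"]
      by (auto simp: Collect_conj_eq)
  next
    fix \<U> assume *: "\<forall>U\<in>\<U>. U \<subseteq> UNIV // asymptotic_rel G \<and> openin left_words {x. limit_map G x \<in> U}"
    have "{x. limit_map G x \<in> \<Union>\<U>} = (\<Union>U\<in>\<U>. {x. limit_map G x \<in> U})" by blast
    then show "openin left_words {x. limit_map G x \<in> \<Union>\<U>}" using * by auto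
    show "\<Union>\<U> \<subseteq> UNIV // asymptotic_rel G" using * by blast
  qed
  then show ?thesis unfolding limit_space_def by (simp add: topology_inverse')
qed

lemma topspace_left_words [simp]: "topspace left_words = UNIV"
  by (simp add: left_words_def)

lemma range_limit_map: "range (limit_map G) = UNIV // asymptotic_rel G"
  by (auto simp: limit_map_def quotient_def)

lemma topspace_limit_space [simp]: "topspace (limit_space G) = UNIV // asymptotic_rel G"
proof -
  have "{x. limit_map G x \<in> UNIV // asymptotic_rel G} = topspace left_words"
    by (auto simp: range_limit_map[symmetric])
  then have "openin (limit_space G) (UNIV // asymptotic_rel G)"
    unfolding openin_limit_space using openin_topspace[of left_words] by simp
  then show ?thesis
    by (metis openin_limit_space openin_subset openin_topspace subset_antisym)
qed

lemma quotient_map_limit_map: "quotient_map left_words (limit_space G) (limit_map G)"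
  by (auto simp: quotient_map_def range_limit_map openin_limit_space)


section \<open>Self-similar structures\<close>

text \<open>\<open>case_nat i s\<close> is the left-infinite word \<open>s\<close> with the letter \<open>i\<close> appended on the right.\<close>

definition associated_surjection ::
    "'a topology \<Rightarrow> ('x \<Rightarrow> 'a \<Rightarrow> 'a) \<Rightarrow> ((nat \<Rightarrow> 'x) \<Rightarrow> 'a) \<Rightarrow> bool" where
  "associated_surjection K F \<pi> \<longleftrightarrow>
     continuous_map left_words K \<pi> \<and> \<pi> ` topspace left_words = topspace K \<and>
     (\<forall>i s. F i (\<pi> s) = \<pi> (case_nat i s))"

definition self_similar_structure :: "'a topology \<Rightarrow> ('x::finite \<Rightarrow> 'a \<Rightarrow> 'a) \<Rightarrow> bool" where
  "self_similar_structure K F \<longleftrightarrow>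
     compact_space K \<and> metrizable_space K \<and>
     (\<forall>i. continuous_map K K (F i) \<and> inj_on (F i) (topspace K)) \<and>
     (\<exists>\<pi>. associated_surjection K F \<pi>)"

end

theory Submission
  imports Defs
begin

text \<open>
  Write \<open>x \<sim> y\<close> for asymptotic equivalence and \<open>xw\<close> for the left-infinite word \<open>x\<close> followed by the
  finite word \<open>w\<close>. The whole proof rests on one fact (\<open>asymptotic_iff_state_path\<close>): \<open>x \<sim> y\<close> holds
  exactly when some left-infinite path in the Moore diagram of the nucleus is labelled by the pairs
  of letters of \<open>x\<close> and \<open>y\<close>. Given the group elements that witness \<open>x \<sim> y\<close>, restrict each of them
  to a long prefix; since there are only finitely many of them, one length sends all of them into
  the nucleus. The resulting finite paths are assembled into an infinite one by Koenig's lemma, as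
  the nucleus is finite. Conversely, the states of a path are themselves witnesses.

  A self-similar structure with associated surjection \<open>p\<close> must satisfy \<open>F\<^sub>i (p x) = p (xi)\<close>, so
  everything depends on how \<open>\<sim>\<close> behaves when letters are appended.

  \<^item> Such an \<open>F\<^sub>i\<close> is well defined iff \<open>x \<sim> y\<close> implies \<open>xi \<sim> yi\<close>. If it is, it is continuous by the
    universal property of the quotient, and it is always injective: deleting the last arrow of a
    path for \<open>xi \<sim> yi\<close> leaves a path for \<open>x \<sim> y\<close> (\<open>asymptotic_truncate\<close>).

  \<^item> The implication from \<open>x \<sim> y\<close> to \<open>xi \<sim> yi\<close>, for all \<open>x\<close>, \<open>y\<close> and \<open>i\<close>, is equivalent to the path
    condition. A path labelled by \<open>xw\<close> and \<open>yw\<close> splits into a path labelled by \<open>x\<close> and \<open>y\<close> and a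
    finite one labelled by \<open>w\<close> and \<open>w\<close>, and the latter says that the state \<open>g\<close> between them has
    \<open>g(w) = w\<close> (\<open>state_path_fixing_word\<close>). In the other direction, a path for \<open>x \<sim> y\<close> that ends at
    a state fixing \<open>i\<close> can be prolonged by one arrow (\<open>asymptotic_append_letter\<close>).

  It remains to know that the limit space is compact and metrizable for every contracting action.
  Membership of \<open>(x, y)\<close> in \<open>\<sim>\<close> can be tested on finite suffixes (\<open>asymptotic_iff_nucleus\<close>), hence
  \<open>\<sim>\<close> is a closed relation on a compact space, \<open>p\<close> is a closed map and the quotient is normal.
  Inequivalent points have finite suffixes whose cylinders have disjoint images. Urysohn functions
  for the countably many pairs of such images separate points and embed the limit space into a
  countable power of the reals.
\<close>


section \<open>Topology of compact quotients\<close>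

text \<open>
  The saturation of a closed set is the projection, along a compact factor, of a closed subset of
  the relation.
\<close>

lemma closed_map_quotient_closed_relation:
  assumes X: "compact_space X" and q: "quotient_map X Y q"
    and R: "closedin (prod_topology X X) {(x, y) \<in> topspace X \<times> topspace X. q x = q y}"
  shows "closed_map X Y q"
  unfolding closed_map_def
proof (intro allI impI)
  fix C assume C: "closedin X C"
  let ?R = "{(x, y) \<in> topspace X \<times> topspace X. q x = q y}"
  have "closedin (prod_topology X X) (?R \<inter> C \<times> topspace X)"
    using R C by (simp add: closedin_Int closedin_prod_Times_iff)
  then have "closedin X (snd ` (?R \<inter> C \<times> topspace X))"
    using closed_map_snd[OF X, of X] by (simp add: closed_map_def)
  moreover have "snd ` (?R \<inter> C \<times> topspace X) = {y \<in> topspace X. q y \<in> q ` C}"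
  proof (intro equalityI subsetI)
    fix y assume "y \<in> {y \<in> topspace X. q y \<in> q ` C}"
    then obtain x where "x \<in> C" "y \<in> topspace X" "q x = q y" by auto
    then show "y \<in> snd ` (?R \<inter> C \<times> topspace X)"
      using closedin_subset[OF C] by (intro image_eqI[of _ _ "(x, y)"]) auto
  qed (use closedin_subset[OF C] in \<open>auto intro: sym rev_image_eqI\<close>)
  ultimately have "closedin X {y \<in> topspace X. q y \<in> q ` C}" by simp
  moreover have "q ` C \<subseteq> topspace Y"
    using closedin_subset[OF C] quotient_imp_surjective_map[OF q] by blast
  ultimately show "closedin Y (q ` C)"
    using q unfolding quotient_map_closedin by blast
qed

text \<open>
  The functions are the coordinates of an injection into a countable power of the reals, and a
  continuous injection from a compact space into a Hausdorff space is an embedding. Countably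
  many coordinates keep the power metrizable.
\<close>

lemma metrizable_space_separating_functions:
  fixes f :: "'i \<Rightarrow> 'a \<Rightarrow> real"
  assumes X: "compact_space X" and I: "countable I"
    and cont: "\<And>i. i \<in> I \<Longrightarrow> continuous_map X euclideanreal (f i)"
    and sep: "\<And>x y. \<lbrakk>x \<in> topspace X; y \<in> topspace X; x \<noteq> y\<rbrakk> \<Longrightarrow> \<exists>i\<in>I. f i x \<noteq> f i y"
  shows "metrizable_space X"
proof -
  let ?P = "product_topology (\<lambda>_::'i. euclideanreal) I"
  let ?F = "\<lambda>x. restrict (\<lambda>i. f i x) I"
  have F: "continuous_map X ?P ?F"
    using cont by (auto simp: continuous_map_componentwise)
  have "closed_map X ?P ?F"
    using continuous_imp_closed_map_gen[OF X _ F]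
    by (simp add: Hausdorff_imp_kc_space Hausdorff_space_product_topology)
  moreover have "inj_on ?F (topspace X)"
  proof (rule inj_onI, rule ccontr)
    fix x y assume xy: "x \<in> topspace X" "y \<in> topspace X" "?F x = ?F y" "x \<noteq> y"
    then obtain i where "i \<in> I" "f i x \<noteq> f i y" using sep by blast
    then show False using fun_cong[OF xy(3), of i] by simp
  qed
  ultimately have "X homeomorphic_space subtopology ?P (?F ` topspace X)"
    using F by (intro embedding_map_imp_homeomorphic_space injective_closed_imp_embedding_map)
  moreover have "metrizable_space ?P"
    using I by (auto simp: metrizable_space_product_topology metrizable_space_euclidean
        intro: countable_subset)
  ultimately show ?thesis
    using homeomorphic_metrizable_space metrizable_space_subtopology by blast
qed


section \<open>Finite suffixes of left-infinite words\<close>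

lemma last_letters_0 [simp]: "last_letters x 0 = []"
  and last_letters_Suc: "last_letters x (Suc k) = x k # last_letters x k"
  and length_last_letters [simp]: "length (last_letters x k) = k"
  by (simp_all add: last_letters_def)

text \<open>
  Letters are counted from the right, so shifting the index by \<open>k\<close> deletes the last \<open>k\<close> letters and
  leaves the prefix in front of them.
\<close>

lemma last_letters_add:
  "last_letters x (k + m) = last_letters (\<lambda>i. x (k + i)) m @ last_letters x k"
  by (induction m) (simp_all add: last_letters_Suc)

text \<open>
  As \<open>case_nat i x\<close> is the word \<open>x\<close> followed by \<open>i\<close>, folding \<open>case_nat\<close> over a finite word \<open>w\<close> appends
  its letters one after the other and gives \<open>xw\<close>.
\<close>

lemma last_letters_append_word:
  "last_letters (fold case_nat w x) (k + length w) = last_letters x k @ w"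
proof (induction w arbitrary: x k)
  case (Cons a w)
  have "last_letters (case_nat a x) (Suc k) = last_letters x k @ [a]"
    by (induction k) (simp_all add: last_letters_Suc)
  then show ?case using Cons.IH[of "case_nat a x" "Suc k"] by simp
qed simp

lemma append_word_shift: "fold case_nat w x (n + length w) = x n"
proof (induction w arbitrary: x n)
  case (Cons a w)
  show ?case using Cons.IH[of "case_nat a x" "Suc n"] by simp
qed simp

lemma openin_suffix: "openin left_words {x. last_letters x n \<in> S}"
proof -
  have *: "openin left_words {x. last_letters x n = u}" for n and u :: "'a list"
  proof (induction n arbitrary: u)
    case 0
    show ?case using openin_topspace[of "left_words :: (nat \<Rightarrow> 'a) topology"]
      by (cases "u = []") auto
  next
    case (Suc n)
    show ?case
    proof (cases u)
      case (Cons a v)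
      have "continuous_map left_words (discrete_topology UNIV) (\<lambda>x::nat \<Rightarrow> 'a. x n)"
        unfolding left_words_def by (rule continuous_map_product_projection) simp
      then have "openin left_words {x \<in> topspace left_words. x n \<in> {a}}"
        by (rule openin_continuous_map_preimage) simp
      moreover have "{x. last_letters x (Suc n) = u}
          = {x \<in> topspace left_words. x n \<in> {a}} \<inter> {x. last_letters x n = v}"
        using Cons by (auto simp: last_letters_Suc)
      ultimately show ?thesis using Suc.IH[of v] by (simp add: openin_Int)
    qed (simp add: last_letters_Suc)
  qed
  have "{x. last_letters x n \<in> S} = (\<Union>u\<in>S. {x. last_letters x n = u})" by blast
  then show ?thesis using * by auto
qed

lemma closedin_suffix: "closedin left_words {x. last_letters x n \<in> S}"
proof -
  have "topspace left_words - {x. last_letters x n \<in> S} = {x. last_letters x n \<in> - S}" by auto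
  then show ?thesis using openin_suffix[of n "- S"] by (simp add: closedin_def)
qed

lemma compact_space_left_words: "compact_space (left_words :: (nat \<Rightarrow> 'x::finite) topology)"
  by (simp add: left_words_def compact_space_product_topology compact_space_discrete_topology)

lemma Hausdorff_space_left_words: "Hausdorff_space left_words"
  by (simp add: left_words_def Hausdorff_space_product_topology)

lemma continuous_map_append_letter: "continuous_map left_words left_words (case_nat i)"
proof -
  have "continuous_map left_words (discrete_topology UNIV) (\<lambda>x. case_nat i x k)" for k
    by (cases k) (auto simp: left_words_def intro: continuous_map_product_projection)
  then show ?thesis
    by (simp add: left_words_def continuous_map_componentwise_UNIV)
qed


section \<open>Koenig's lemma\<close>

text \<open>
  Read \<open>h k\<close> as a finite sequence \<open>h k 0, \<dots>, h k k\<close>; the sequences grow with \<open>k\<close>. By the pigeonhole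
  principle, infinite sets \<open>K\<^sub>0 \<supseteq> K\<^sub>1 \<supseteq> \<dots>\<close> of indices can be chosen such that \<open>h k n\<close> does not depend
  on \<open>k \<in> K\<^sub>n\<close>; the limit sequence \<open>s\<close> collects these values. A path is determined by conditions on
  adjacent states, so agreement with some \<open>h k\<close> at \<open>n\<close> and \<open>n + 1\<close> is all that a limit of paths needs.
\<close>

lemma koenig_adjacent:
  fixes h :: "nat \<Rightarrow> nat \<Rightarrow> 'a"
  assumes N: "finite N" and h: "\<And>k n. n \<le> k \<Longrightarrow> h k n \<in> N"
  obtains s where "\<And>n. \<exists>k>n. h k n = s n \<and> h k (Suc n) = s (Suc n)"
proof -
  let ?P = "\<lambda>n K. infinite K \<and> K \<subseteq> {n..} \<and> (\<exists>c. \<forall>k\<in>K. h k n = c)"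
  have refine: "\<exists>K'. ?P n K' \<and> K' \<subseteq> K" if "infinite K" for n and K :: "nat set"
  proof -
    have "K \<inter> {n..} = K - {..<n}" by auto
    then have inf: "infinite (K \<inter> {n..})" using that by simp
    have "(\<lambda>k. h k n) ` (K \<inter> {n..}) \<subseteq> N" using h by auto
    then have "finite ((\<lambda>k. h k n) ` (K \<inter> {n..}))" using N finite_subset by blast
    from pigeonhole_infinite[OF inf this] obtain a where
      "infinite {k \<in> K \<inter> {n..}. h k n = h a n}" by auto
    then show ?thesis by (intro exI[of _ "{k \<in> K \<inter> {n..}. h k n = h a n}"]) auto
  qed
  have "\<exists>K. \<forall>n. ?P n (K n) \<and> K (Suc n) \<subseteq> K n"
  proof (rule dependent_nat_choice)
    show "\<exists>K. ?P 0 K" using refine[of UNIV 0] by blast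
    show "\<exists>K'. ?P (Suc n) K' \<and> K' \<subseteq> K" if "?P n K" for n K
      using refine[of K "Suc n"] that by blast
  qed
  then obtain K where "\<forall>n. ?P n (K n) \<and> K (Suc n) \<subseteq> K n" ..
  then have K: "infinite (K n)" "K n \<subseteq> {n..}" "K (Suc n) \<subseteq> K n"
    and const: "\<exists>c. \<forall>k\<in>K n. h k n = c" for n
    by simp_all
  obtain s where s: "\<And>n k. k \<in> K n \<Longrightarrow> h k n = s n" using const by metis
  show ?thesis
  proof
    fix n
    obtain k where k: "k \<in> K (Suc n)" using infinite_imp_nonempty[OF K(1)] by blast
    then have "k > n" using K(2)[of "Suc n"] by auto
    then show "\<exists>k>n. h k n = s n \<and> h k (Suc n) = s (Suc n)"
      using k s K(3) by blast
  qed
qed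


section \<open>Restrictions and the nucleus\<close>

lemma restr_restr:
  assumes "tree_automorphism g"
  shows "restr (restr g u) v = restr g (u @ v)"
proof
  fix w
  have "length (restr g u v) = length v"
    using assms by (simp add: restr_def tree_automorphism_length)
  then show "restr (restr g u) v w = restr g (u @ v) w"
    using assms by (simp add: restr_def tree_automorphism_length add.commute)
qed

text \<open>
  A left-infinite path in the Moore diagram, presented by its label (split into two words) and its
  states: \<open>s (Suc n)\<close> is the start and \<open>s n\<close> the end of the arrow \<open>e\<^sub>n\<^sub>+\<^sub>1\<close>, so the path ends at \<open>s 0\<close>.
\<close>

definition state_path ::
    "('x list \<Rightarrow> 'x list) set \<Rightarrow> (nat \<Rightarrow> 'x) \<Rightarrow> (nat \<Rightarrow> 'x) \<Rightarrow> (nat \<Rightarrow> 'x list \<Rightarrow> 'x list) \<Rightarrow> bool" where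
  "state_path N x y s \<longleftrightarrow>
     (\<forall>n. s n \<in> N \<and> s (Suc n) [x n] = [y n] \<and> restr (s (Suc n)) [x n] = s n)"

locale contracting_action =
  fixes G :: "('x::finite list \<Rightarrow> 'x list) set"
  assumes self_similar: "self_similar_action G" and contracting: "contracting G"
begin

lemma automorphism: "g \<in> G \<Longrightarrow> tree_automorphism g"
  using self_similar subgroup.subset[of G tree_Aut]
  by (auto simp: self_similar_action_def tree_Aut_def)

lemma finite_nucleus: "finite (nucleus G)"
  and nucleus_subset: "nucleus G \<subseteq> G"
  and nucleus_absorbs: "g \<in> G \<Longrightarrow> \<exists>k. \<forall>w. length w \<ge> k \<longrightarrow> restr g w \<in> nucleus G"
  using nucleus_least(1)[OF contracting] by (auto simp: absorbing_set_def)

lemma nucleus_automorphism: "g \<in> nucleus G \<Longrightarrow> tree_automorphism g"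
  using automorphism nucleus_subset by blast

text \<open>
  The elements of the nucleus all of whose restrictions lie in the nucleus still form an absorbing
  set, because restricting twice is restricting along a longer word. By minimality they are the
  whole nucleus.
\<close>

lemma restr_nucleus:
  assumes "g \<in> nucleus G"
  shows "restr g v \<in> nucleus G"
proof -
  let ?M = "{g \<in> nucleus G. \<forall>v. restr g v \<in> nucleus G}"
  have "absorbing_set G ?M"
    unfolding absorbing_set_def
  proof (intro conjI ballI)
    fix g assume g: "g \<in> G"
    then obtain k where k: "\<And>w. length w \<ge> k \<Longrightarrow> restr g w \<in> nucleus G"
      using nucleus_absorbs by blast
    have "restr g w \<in> ?M" if "length w \<ge> k" for w
      using that k[of w] k[of "w @ v" for v] by (simp add: restr_restr automorphism[OF g])
    then show "\<exists>k. \<forall>w. length w \<ge> k \<longrightarrow> restr g w \<in> ?M" by blast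
  qed (use finite_nucleus nucleus_subset in auto)
  then show ?thesis using nucleus_least(2)[OF contracting] assms by blast
qed

text \<open>
  A Moore path lists only start states that are required to lie in the nucleus; the end state does
  so because the nucleus is closed under restriction.
\<close>

lemma moore_path_iff_state_path:
  "(\<exists>e. left_infinite_path (nucleus G) e \<and> (\<forall>n. arrow_label (e n) = (x n, y n)) \<and> path_end e = g)
    \<longleftrightarrow> (\<exists>s. state_path (nucleus G) x y s \<and> s 0 = g)" (is "?L \<longleftrightarrow> ?R")
proof
  assume ?L
  then obtain e where e: "\<And>n. e n \<in> moore_arrows (nucleus G)"
    "\<And>n. arrow_end (e (Suc n)) = arrow_start (e n)"
    "\<And>n. arrow_label (e n) = (x n, y n)" "path_end e = g"
    by (auto simp: left_infinite_path_def)
  define s where "s n = arrow_end (e n)" for n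
  have arrow: "arrow_start (e n) \<in> nucleus G \<and> arrow_start (e n) [x n] = [y n]
      \<and> s n = restr (arrow_start (e n)) [x n]" for n
    using e(1)[of n] e(3)[of n]
    by (auto simp: moore_arrows_def s_def arrow_start_def arrow_label_def arrow_end_def)
  have "s (Suc n) = arrow_start (e n)" for n using e(2) by (simp add: s_def)
  moreover have "s n \<in> nucleus G" for n using arrow[of n] restr_nucleus by simp
  ultimately have "state_path (nucleus G) x y s"
    using arrow by (simp add: state_path_def)
  then show ?R using e(4) by (auto simp: s_def path_end_def)
next
  assume ?R
  then obtain s where s: "state_path (nucleus G) x y s" "s 0 = g" by blast
  let ?e = "\<lambda>n. (s (Suc n), (x n, y n), s n)"
  have "?e n \<in> moore_arrows (nucleus G)" for n
    using s(1) unfolding moore_arrows_def state_path_def by force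
  then show ?L using s(2)
    by (intro exI[of _ ?e]) (simp add: left_infinite_path_def arrow_start_def arrow_label_def
        arrow_end_def path_end_def)
qed

text \<open>
  The state at depth \<open>k\<close> acts on the first \<open>k\<close> letters as the label of the path prescribes, and
  what remains of the word is left to the end state.
\<close>

lemma state_path_action:
  assumes s: "state_path (nucleus G) x y s"
  shows "s k (last_letters x k @ w) = last_letters y k @ s 0 w"
proof (induction k)
  case (Suc k)
  have "tree_automorphism (s (Suc k))"
    using s nucleus_automorphism by (auto simp: state_path_def)
  from restr_eq[OF this, of "[x k]" "last_letters x k @ w"] show ?case
    using s Suc.IH by (simp add: last_letters_Suc state_path_def)
qed simp


section \<open>Asymptotic equivalence and the nucleus\<close>

lemma restr_maps_suffix:
  assumes "tree_automorphism g" and "g (last_letters x (k + m)) = last_letters y (k + m)"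
  shows "restr g (last_letters (\<lambda>i. x (k + i)) m) (last_letters x k) = last_letters y k"
proof -
  let ?u = "last_letters (\<lambda>i. x (k + i)) m"
  have "g ?u @ restr g ?u (last_letters x k) = last_letters (\<lambda>i. y (k + i)) m @ last_letters y k"
    using assms restr_eq[OF assms(1), of ?u "last_letters x k"] by (simp add: last_letters_add)
  moreover have "length (g ?u) = length (last_letters (\<lambda>i. y (k + i)) m)"
    using tree_automorphism_length[OF assms(1)] by simp
  ultimately show ?thesis by simp
qed

text \<open>
  The witnesses \<open>g\<^sub>k\<close> take finitely many values, so restrictions along words of a common length \<open>m\<close>
  lie in the nucleus. Hence the restriction of \<open>g\<^sub>k\<^sub>+\<^sub>m\<close> along the first \<open>m\<close> of the last \<open>k + m\<close>
  letters of \<open>x\<close> is an element of the nucleus that does the work of \<open>g\<^sub>k\<close>.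
\<close>

lemma asymptotic_imp_nucleus:
  assumes "(x, y) \<in> asymptotic_rel G"
  shows "\<exists>g\<in>nucleus G. g (last_letters x k) = last_letters y k"
proof -
  obtain g where g: "\<And>k. k \<ge> 1 \<Longrightarrow> g k \<in> G" "finite (g ` {1..})"
    "\<And>k. k \<ge> 1 \<Longrightarrow> g k (last_letters x k) = last_letters y k"
    using assms unfolding asymptotic_rel_def by auto
  have "\<forall>a\<in>g ` {1..}. \<exists>k. \<forall>w. length w \<ge> k \<longrightarrow> restr a w \<in> nucleus G"
    using g(1) nucleus_absorbs by auto
  then obtain depth where depth:
    "\<And>a w. \<lbrakk>a \<in> g ` {1..}; length w \<ge> depth a\<rbrakk> \<Longrightarrow> restr a w \<in> nucleus G"
    by metis
  \<comment> \<open>The witnesses exist only from index 1 on; the successor makes \<open>k + m\<close> positive.\<close>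
  define m where "m = Suc (Max (depth ` g ` {1..}))"
  have *: "k + m \<ge> 1" by (simp add: m_def)
  have "depth (g (k + m)) \<le> m"
    unfolding m_def by (intro le_SucI Max_ge) (use g(2) in auto)
  then have "restr (g (k + m)) (last_letters (\<lambda>i. x (k + i)) m) \<in> nucleus G"
    using * by (intro depth) auto
  then show ?thesis
    using restr_maps_suffix[OF automorphism[OF g(1)[OF *]] g(3)[OF *]] by blast
qed

text \<open>
  Restricting \<open>g\<^sub>k\<close> along longer and longer prefixes of \<open>x\<^sub>k \<dots> x\<^sub>1\<close> gives the states of a path of
  length \<open>k\<close> inside the nucleus, with the desired labels; a limit of these paths is infinite.
\<close>

lemma nucleus_imp_state_path:
  assumes "\<And>k. \<exists>g\<in>nucleus G. g (last_letters x k) = last_letters y k"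
  shows "\<exists>s. state_path (nucleus G) x y s"
proof -
  obtain g where g: "\<And>k. g k \<in> nucleus G" "\<And>k. g k (last_letters x k) = last_letters y k"
    using assms by metis
  \<comment> \<open>The state that \<open>g k\<close> reaches after reading all but the last \<open>n\<close> of its \<open>k\<close> letters.\<close>
  define h where "h k n = restr (g k) (last_letters (\<lambda>i. x (n + i)) (k - n))" for k n
  have h: "h k n \<in> nucleus G" for k n
    using g(1) restr_nucleus by (simp add: h_def)
  then obtain s where s: "\<And>n. \<exists>k>n. h k n = s n \<and> h k (Suc n) = s (Suc n)"
    using koenig_adjacent[OF finite_nucleus, of h] by blast
  have step: "h k (Suc n) [x n] = [y n] \<and> restr (h k (Suc n)) [x n] = h k n" if "n < k" for k n
  proof
    obtain m where k: "k = Suc n + m" using \<open>n < k\<close> less_iff_Suc_add by auto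
    have aut: "tree_automorphism (g k)" "tree_automorphism (h k (Suc n))"
      using nucleus_automorphism g(1) h by auto
    have "h k (Suc n) (last_letters x (Suc n)) = last_letters y (Suc n)"
      using restr_maps_suffix[OF aut(1), of x "Suc n" m y] g(2)[of k]
      by (simp add: h_def k)
    then have "h k (Suc n) [x n] @ restr (h k (Suc n)) [x n] (last_letters x n)
        = [y n] @ last_letters y n"
      using restr_eq[OF aut(2), of "[x n]" "last_letters x n"] by (simp add: last_letters_Suc)
    moreover have "length (h k (Suc n) [x n]) = length [y n]"
      using tree_automorphism_length[OF aut(2)] by simp
    ultimately show "h k (Suc n) [x n] = [y n]" using append_eq_append_conv by blast
    have "last_letters (\<lambda>i. x (n + i)) (Suc m) = last_letters (\<lambda>i. x (Suc n + i)) m @ [x n]"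
      using last_letters_add[of "\<lambda>i. x (n + i)" 1 m] by (simp add: last_letters_Suc)
    then show "restr (h k (Suc n)) [x n] = h k n"
      using aut(1) by (simp add: h_def k restr_restr)
  qed
  have "state_path (nucleus G) x y s"
    unfolding state_path_def using s step h by metis
  then show ?thesis by blast
qed

lemma state_path_imp_asymptotic:
  assumes s: "state_path (nucleus G) x y s"
  shows "(x, y) \<in> asymptotic_rel G"
proof -
  have N: "s n \<in> nucleus G" for n using s by (simp add: state_path_def)
  then have "finite (s ` {1..})" by (intro finite_subset[OF _ finite_nucleus]) auto
  moreover have "s k (last_letters x k) = last_letters y k" for k
  proof -
    have "s 0 [] = []" using nucleus_automorphism[OF N] by (simp add: tree_automorphism_def)
    then show ?thesis using state_path_action[OF s, of k "[]"] by simp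
  qed
  ultimately show ?thesis
    unfolding asymptotic_rel_def using N nucleus_subset by blast
qed

text \<open>
  For a fixed finite set of group elements the condition may be tested suffix by suffix, which
  exhibits asymptotic equivalence as an intersection of clopen relations.
\<close>

lemma asymptotic_iff_nucleus:
  "(x, y) \<in> asymptotic_rel G \<longleftrightarrow>
     (\<forall>k. \<exists>g\<in>nucleus G. g (last_letters x k) = last_letters y k)"
  using asymptotic_imp_nucleus nucleus_imp_state_path state_path_imp_asymptotic by blast

lemma asymptotic_iff_state_path:
  "(x, y) \<in> asymptotic_rel G \<longleftrightarrow> (\<exists>s. state_path (nucleus G) x y s)"
  using asymptotic_iff_nucleus nucleus_imp_state_path state_path_imp_asymptotic by blast

lemma limit_map_eq_iff: "limit_map G x = limit_map G y \<longleftrightarrow> (x, y) \<in> asymptotic_rel G"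
proof -
  have "equiv UNIV (asymptotic_rel G)"
    using self_similar by (intro equiv_asymptotic_rel) (simp add: self_similar_action_def)
  then show ?thesis by (simp add: limit_map_def eq_equiv_class_iff)
qed


section \<open>The limit space is compact and metrizable\<close>

text \<open>
  If no element of the nucleus maps a suffix of \<open>x\<close> to the suffix of \<open>y\<close> of the same length, then
  this persists for all words with these suffixes.
\<close>

lemma closedin_asymptotic_rel: "closedin (prod_topology left_words left_words) (asymptotic_rel G)"
proof -
  let ?W = "\<lambda>k (u::'x list) (v::'x list).
    {x. last_letters x k \<in> {u}} \<times> {y. last_letters y k \<in> {v}}"
  have "- asymptotic_rel G = (\<Union>(k, u, v) \<in> {(k, u, v). \<forall>g\<in>nucleus G. g u \<noteq> v}. ?W k u v)"
    by (fastforce simp: asymptotic_iff_nucleus)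
  moreover have "openin (prod_topology left_words left_words) (?W k u v)" for k u v
    by (simp only: openin_prod_Times_iff openin_suffix simp_thms)
  ultimately have "openin (prod_topology left_words left_words) (- asymptotic_rel G)" by auto
  then show ?thesis by (simp add: closedin_def Compl_eq_Diff_UNIV)
qed

lemma closed_map_limit_map: "closed_map left_words (limit_space G) (limit_map G)"
proof (rule closed_map_quotient_closed_relation[OF compact_space_left_words quotient_map_limit_map])
  have "{(x, y) \<in> topspace left_words \<times> topspace left_words. limit_map G x = limit_map G y}
      = asymptotic_rel G"
    by (auto simp: limit_map_eq_iff)
  then show "closedin (prod_topology left_words left_words)
      {(x, y) \<in> topspace left_words \<times> topspace left_words. limit_map G x = limit_map G y}"
    by (simp only: closedin_asymptotic_rel)
qed

lemma continuous_map_limit_map: "continuous_map left_words (limit_space G) (limit_map G)"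
  by (rule quotient_imp_continuous_map[OF quotient_map_limit_map])

lemma compact_space_limit_space: "compact_space (limit_space G)"
proof -
  have "compactin (limit_space G) (limit_map G ` topspace left_words)"
    using compact_space_left_words continuous_map_limit_map
    by (intro image_compactin) (auto simp: compact_space_def)
  then show ?thesis by (simp add: compact_space_def range_limit_map)
qed

lemma normal_space_limit_space: "normal_space (limit_space G)"
proof (rule normal_space_continuous_closed_map_image[OF _ continuous_map_limit_map
      closed_map_limit_map])
  show "normal_space (left_words :: (nat \<Rightarrow> 'x) topology)"
    using compact_space_left_words Hausdorff_space_left_words
    by (blast intro: compact_Hausdorff_or_regular_imp_normal_space)
qed (simp add: range_limit_map)

text \<open>
  If \<open>x\<close> and \<open>y\<close> are inequivalent, this is already seen on suffixes \<open>u\<close> and \<open>v\<close>, and then no word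
  ending in \<open>u\<close> is equivalent to a word ending in \<open>v\<close>. The images of the two cylinders are thus
  disjoint closed sets, and pairs of finite words form a countable index set for functions that
  separate them.
\<close>

lemma metrizable_space_limit_space: "metrizable_space (limit_space G)"
proof -
  define cyl where "cyl u = limit_map G ` {x. last_letters x (length u) \<in> {u}}" for u :: "'x list"
  have cyl: "closedin (limit_space G) (cyl u)" for u
    using closed_map_limit_map closedin_suffix unfolding cyl_def closed_map_def by blast
  \<comment> \<open>Pairs with intersecting images get the zero function, so that all pairs can serve as indices.\<close>
  have "\<exists>f. continuous_map (limit_space G) euclideanreal f \<and>
      (disjnt (cyl u) (cyl v) \<longrightarrow> f ` cyl u \<subseteq> {0} \<and> f ` cyl v \<subseteq> {1})" for u v
  proof (cases "disjnt (cyl u) (cyl v)")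
    case True
    obtain f where "continuous_map (limit_space G) euclideanreal f" "f ` cyl u \<subseteq> {0}"
      "f ` cyl v \<subseteq> {1}"
      by (rule Urysohn_lemma_alt[OF normal_space_limit_space cyl cyl True])
    then show ?thesis by blast
  next
    case False
    have "continuous_map (limit_space G) euclideanreal (\<lambda>_. 0)" by simp
    with False show ?thesis by blast
  qed
  then obtain f where f: "\<And>u v. continuous_map (limit_space G) euclideanreal (f u v)"
    "\<And>u v. disjnt (cyl u) (cyl v) \<Longrightarrow> f u v ` cyl u \<subseteq> {0} \<and> f u v ` cyl v \<subseteq> {1::real}"
    by metis
  show ?thesis
  proof (rule metrizable_space_separating_functions[OF compact_space_limit_space,
        of UNIV "\<lambda>(u, v). f u v"])
    fix a b
    assume ab: "a \<in> topspace (limit_space G)" "b \<in> topspace (limit_space G)" "a \<noteq> b"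
    then obtain x y where xy: "a = limit_map G x" "b = limit_map G y"
      by (auto simp: range_limit_map[symmetric])
    then obtain k where k: "\<And>g. g \<in> nucleus G \<Longrightarrow> g (last_letters x k) \<noteq> last_letters y k"
      using ab(3) by (auto simp: limit_map_eq_iff asymptotic_iff_nucleus)
    let ?u = "last_letters x k" and ?v = "last_letters y k"
    have "disjnt (cyl ?u) (cyl ?v)"
    proof -
      have False if "last_letters x' k = ?u" "last_letters y' k = ?v"
        "limit_map G x' = limit_map G y'" for x' y'
        using that k by (metis limit_map_eq_iff asymptotic_iff_nucleus)
      then show ?thesis by (auto simp: disjnt_iff cyl_def)
    qed
    moreover have "a \<in> cyl ?u" "b \<in> cyl ?v" by (auto simp: xy cyl_def)
    ultimately have "f ?u ?v a = 0" "f ?u ?v b = 1" using f(2) by blast+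
    then show "\<exists>i\<in>UNIV. (case i of (u, v) \<Rightarrow> f u v) a \<noteq> (case i of (u, v) \<Rightarrow> f u v) b"
      by (intro bexI[of _ "(?u, ?v)"]) auto
  qed (auto simp: f(1))
qed


section \<open>Appending letters\<close>

text \<open>
  Deleting the last arrow of a path. This is why the maps \<open>F\<^sub>i\<close> are injective as soon as they exist.
\<close>

lemma asymptotic_truncate:
  assumes "(case_nat i x, case_nat i y) \<in> asymptotic_rel G"
  shows "(x, y) \<in> asymptotic_rel G"
proof -
  obtain s where s: "state_path (nucleus G) (case_nat i x) (case_nat i y) s"
    using assms by (auto simp: asymptotic_iff_state_path)
  have "state_path (nucleus G) x y (\<lambda>n. s (Suc n))"
    unfolding state_path_def
  proof
    fix n
    show "s (Suc n) \<in> nucleus G \<and> s (Suc (Suc n)) [x n] = [y n] \<and>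
        restr (s (Suc (Suc n))) [x n] = s (Suc n)"
      using s[unfolded state_path_def, rule_format, of "Suc n"] by simp
  qed
  then show ?thesis by (auto simp: asymptotic_iff_state_path)
qed

text \<open>
  As the end state fixes \<open>i\<close>, the arrow that leaves it along \<open>i\<close> has label \<open>(i, i)\<close> and stays in the nucleus, so it
  prolongs the path.
\<close>

lemma asymptotic_append_letter:
  assumes s: "state_path (nucleus G) x y s" and i: "s 0 [i] = [i]"
  shows "(case_nat i x, case_nat i y) \<in> asymptotic_rel G"
proof -
  have "state_path (nucleus G) (case_nat i x) (case_nat i y) (case_nat (restr (s 0) [i]) s)"
    unfolding state_path_def
  proof
    fix n
    show "case_nat (restr (s 0) [i]) s n \<in> nucleus G \<and>
        case_nat (restr (s 0) [i]) s (Suc n) [case_nat i x n] = [case_nat i y n] \<and>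
        restr (case_nat (restr (s 0) [i]) s (Suc n)) [case_nat i x n]
          = case_nat (restr (s 0) [i]) s n"
      using s i restr_nucleus by (cases n) (auto simp: state_path_def)
  qed
  then show ?thesis by (auto simp: asymptotic_iff_state_path)
qed

text \<open>
  Cut a path labelled by \<open>xw\<close> and \<open>yw\<close> in front of its last \<open>length w\<close> arrows: the state at the cut
  reads \<open>w\<close> and writes \<open>w\<close>.
\<close>

lemma state_path_fixing_word:
  assumes "(fold case_nat w x, fold case_nat w y) \<in> asymptotic_rel G"
  obtains s where "state_path (nucleus G) x y s" "s 0 w = w"
proof -
  obtain s where s: "state_path (nucleus G) (fold case_nat w x) (fold case_nat w y) s"
    using assms by (auto simp: asymptotic_iff_state_path)
  have "state_path (nucleus G) x y (\<lambda>n. s (n + length w))"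
    unfolding state_path_def
  proof
    fix n
    show "s (n + length w) \<in> nucleus G \<and> s (Suc n + length w) [x n] = [y n] \<and>
        restr (s (Suc n + length w)) [x n] = s (n + length w)"
      using s[unfolded state_path_def, rule_format, of "n + length w"]
      by (simp add: append_word_shift)
  qed
  moreover have "s (length w) w = w"
  proof -
    have "s 0 [] = []"
      using s nucleus_automorphism by (auto simp: state_path_def tree_automorphism_def)
    then show ?thesis
      using state_path_action[OF s, of "length w" "[]"] last_letters_append_word[of w _ 0] by simp
  qed
  ultimately show ?thesis using that[of "\<lambda>n. s (n + length w)"] by simp
qed

lemma self_similar_structure_iff_append_invariant:
  "(\<exists>F. self_similar_structure (limit_space G) F \<and>
      associated_surjection (limit_space G) F (limit_map G)) \<longleftrightarrow>
    (\<forall>x y i. (x, y) \<in> asymptotic_rel G \<longrightarrow> (case_nat i x, case_nat i y) \<in> asymptotic_rel G)"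
    (is "?L \<longleftrightarrow> ?R")
proof
  assume ?L
  then obtain F where "\<And>i s. F i (limit_map G s) = limit_map G (case_nat i s)"
    by (auto simp: associated_surjection_def)
  then show ?R by (metis limit_map_eq_iff)
next
  assume R: ?R
  have "\<exists>f. continuous_map (limit_space G) (limit_space G) f \<and>
      (\<forall>x. f (limit_map G x) = limit_map G (case_nat i x))" for i
  proof -
    have "continuous_map left_words (limit_space G) (limit_map G \<circ> case_nat i)"
      by (rule continuous_map_compose[OF continuous_map_append_letter continuous_map_limit_map])
    moreover have "(limit_map G \<circ> case_nat i) x = (limit_map G \<circ> case_nat i) y"
      if "limit_map G x = limit_map G y" for x y
      using that R by (simp add: limit_map_eq_iff)
    ultimately show ?thesis
      using quotient_map_lift_exists[OF quotient_map_limit_map,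
          of "limit_space G" "limit_map G \<circ> case_nat i"]
      by (metis UNIV_I comp_apply topspace_left_words)
  qed
  then obtain F where cont: "\<And>i. continuous_map (limit_space G) (limit_space G) (F i)"
    and F: "\<And>i x. F i (limit_map G x) = limit_map G (case_nat i x)"
    by metis
  have "inj_on (F i) (topspace (limit_space G))" for i
  proof (rule inj_onI)
    fix a b
    assume ab: "a \<in> topspace (limit_space G)" "b \<in> topspace (limit_space G)" "F i a = F i b"
    then obtain x y where "a = limit_map G x" "b = limit_map G y"
      by (auto simp: range_limit_map[symmetric])
    then show "a = b" using ab(3) asymptotic_truncate by (simp add: F limit_map_eq_iff)
  qed
  moreover have "associated_surjection (limit_space G) F (limit_map G)"
    by (simp add: associated_surjection_def continuous_map_limit_map range_limit_map F)
  ultimately show ?L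
    using cont compact_space_limit_space metrizable_space_limit_space
    unfolding self_similar_structure_def by blast
qed

text \<open>
  From left to right, the invariance is iterated along \<open>w\<close> and the resulting path is cut; from right
  to left, words \<open>w\<close> of a single letter suffice.
\<close>

lemma append_invariant_iff_state_path_fixing:
  "(\<forall>x y i. (x, y) \<in> asymptotic_rel G \<longrightarrow> (case_nat i x, case_nat i y) \<in> asymptotic_rel G) \<longleftrightarrow>
   (\<forall>x y s w. state_path (nucleus G) x y s \<longrightarrow>
      (\<exists>t. state_path (nucleus G) x y t \<and> t 0 w = w))" (is "?L \<longleftrightarrow> ?R")
proof
  assume L: ?L
  have append: "(fold case_nat w x, fold case_nat w y) \<in> asymptotic_rel G"
    if "(x, y) \<in> asymptotic_rel G" for x y and w :: "'x list"
    using that by (induction w arbitrary: x y) (use L in auto)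
  show ?R
    using state_path_fixing_word append state_path_imp_asymptotic by metis
next
  assume ?R
  then show ?L using asymptotic_append_letter by (metis asymptotic_iff_state_path)
qed

text \<open>
  For a path that ends at the identity, the path itself is the one looked for. Therefore the
  condition may be imposed on all paths, whatever their end state.
\<close>

lemma path_condition_iff_state_path_fixing:
  "(\<forall>e w. left_infinite_path (nucleus G) e \<and> path_end e \<noteq> id \<longrightarrow>
      (\<exists>f. left_infinite_path (nucleus G) f \<and>
           (\<forall>n. arrow_label (f n) = arrow_label (e n)) \<and> path_end f w = w)) \<longleftrightarrow>
   (\<forall>x y s w. state_path (nucleus G) x y s \<longrightarrow>
      (\<exists>t. state_path (nucleus G) x y t \<and> t 0 w = w))" (is "?L \<longleftrightarrow> ?R")
proof
  assume L: ?L
  show ?R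
  proof (intro allI impI)
    fix x y s and w :: "'x list"
    assume s: "state_path (nucleus G) x y s"
    show "\<exists>t. state_path (nucleus G) x y t \<and> t 0 w = w"
    proof (cases "s 0 = id")
      case True
      then show ?thesis using s by auto
    next
      case False
      obtain e where e: "left_infinite_path (nucleus G) e"
        "\<And>n. arrow_label (e n) = (x n, y n)" "path_end e = s 0"
        using s moore_path_iff_state_path[of x y "s 0"] by blast
      then obtain f where "left_infinite_path (nucleus G) f"
        "\<And>n. arrow_label (f n) = (x n, y n)" "path_end f w = w"
        using L False by metis
      then show ?thesis using moore_path_iff_state_path[of x y "path_end f"] by metis
    qed
  qed
next
  assume R: ?R
  show ?L
  proof (intro allI impI, elim conjE)
    fix e and w :: "'x list"
    assume e: "left_infinite_path (nucleus G) e"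
    let ?x = "\<lambda>n. fst (arrow_label (e n))" and ?y = "\<lambda>n. snd (arrow_label (e n))"
    have "\<exists>s. state_path (nucleus G) ?x ?y s"
      using e moore_path_iff_state_path[of ?x ?y "path_end e"] by auto
    then obtain t where "state_path (nucleus G) ?x ?y t" "t 0 w = w" using R by blast
    then show "\<exists>f. left_infinite_path (nucleus G) f \<and>
        (\<forall>n. arrow_label (f n) = arrow_label (e n)) \<and> path_end f w = w"
      using moore_path_iff_state_path[of ?x ?y "t 0"] by (metis prod.collapse)
  qed
qed

end

theorem theorem3p5:
  fixes G :: "('x::finite list \<Rightarrow> 'x list) set"
  assumes "self_similar_action G" and "contracting G"
  shows "(\<exists>F. self_similar_structure (limit_space G) F \<and>
              associated_surjection (limit_space G) F (limit_map G)) \<longleftrightarrow>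
         (\<forall>e w. left_infinite_path (nucleus G) e \<and> path_end e \<noteq> id \<longrightarrow>
            (\<exists>f. left_infinite_path (nucleus G) f \<and>
                 (\<forall>n. arrow_label (f n) = arrow_label (e n)) \<and>
                 path_end f w = w))"
proof -
  interpret contracting_action G using assms by unfold_locales
  show ?thesis
    by (simp only: self_similar_structure_iff_append_invariant
        append_invariant_iff_state_path_fixing path_condition_iff_state_path_fixing)
qed

end
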